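(* Let $\alpha=\alpha(t)$ be a function, and let $t=\varphi(x,y,p)$, $u=\psi(x,y,p)$, with $p=y'$, be a (non-contact) first-order tangent transformation, i.e. $$\varphi_{p}(\psi_{x}+p\psi_{y})-\psi_{p}(\varphi_{x}+p\varphi_{y})\neq 0 .$$ Then any fourth-order ordinary differential equation for $y(x)$ obtained by this transformation from the linear third-order equation $u'''+\alpha(t)u=0$ has one of the following two forms: either $$y^{(4)}+(A_{1}y''+A_{0})y'''+B_{3}(y'')^{3}+B_{2}(y'')^{2}+B_{1}y''+B_{0}=0,$$ where $A_i=A_i(x,y,p)$ and $B_j=B_j(x,y,p)$ are some functions of $x,y,p$; or $$y^{(4)}+\frac{1}{y''+r}\Big[-3(y''')^{2}+\big(C_{2}(y'')^{2}+C_{1}y''+C_{0}\big)y'''+D_{5}(y'')^{5}+D_{4}(y'')^{4}+D_{3}(y'')^{3}+D_{2}(y'')^{2}+D_{1}y''+D_{0}\Big]=0,$$ where $r=r(x,y,p)$, $C_i=C_i(x,y,p)$ and $D_j=D_j(x,y,p)$ are some functions of $x,y,p$.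
   Context: Everything is local and all functions are sufficiently smooth; conditions "$=0$" and "$\neq 0$" on functions mean identically zero, respectively nowhere zero, on the domain considered, and $\varphi_p$ is either identically zero or nowhere zero. Subscripts $x,y,p$ denote partial derivatives, with $x,y,p$ treated as independent variables and $p=y'$. The total derivative is $D=\partial_x+y'\partial_y+y''\partial_{y'}+y'''\partial_{y''}+\cdots$. A first-order tangent transformation $t=\varphi(x,y,p)$, $u=\psi(x,y,p)$ changes derivatives by $$u'=\frac{D\psi}{D\varphi},\qquad u''=\frac{Du'}{D\varphi},\qquad u'''=\frac{Du''}{D\varphi}.$$ The transformation is a contact transformation when $\psi_p(\varphi_x+p\varphi_y)=\varphi_p(\psi_x+p\psi_y)$; this case is excluded. The fourth-order equation "obtained from" $u'''+\alpha(t)u=0$ is the equation resulting from substituting these expressions together with $t=\varphi$, $u=\psi$, normalized so that the coefficient of $y^{(4)}$ equals $1$. *)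

theory Defs
  imports "HOL-Analysis.Analysis"
begin

definition partial_deriv :: "'a::real_normed_vector \<Rightarrow> ('a \<Rightarrow> real) \<Rightarrow> 'a \<Rightarrow> real" where
  "partial_deriv b f z = deriv (\<lambda>s. f (z + s *\<^sub>R b)) 0"

(* Intended for open S. Requiring total differentiability at each step gives the usual
   class C^n, since functions with continuous partial derivatives are differentiable. *)
primrec C_k_on :: "nat \<Rightarrow> 'a::euclidean_space set \<Rightarrow> ('a \<Rightarrow> real) \<Rightarrow> bool" where
  "C_k_on 0 S f \<longleftrightarrow> continuous_on S f"
| "C_k_on (Suc n) S f \<longleftrightarrow>
     f differentiable_on S \<and> (\<forall>b\<in>Basis. C_k_on n S (partial_deriv b f))"

(* Points (x, y, p) with p = y'. *)
type_synonym point = "real \<times> real \<times> real"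

(* Points (x, y, y', y'', y''', y'''') of the fourth-order jet space. *)
type_synonym jet = "real \<times> real \<times> real \<times> real \<times> real \<times> real"

abbreviation d_x :: "(point \<Rightarrow> real) \<Rightarrow> point \<Rightarrow> real" where
  "d_x \<equiv> partial_deriv (1, 0, 0)"

abbreviation d_y :: "(point \<Rightarrow> real) \<Rightarrow> point \<Rightarrow> real" where
  "d_y \<equiv> partial_deriv (0, 1, 0)"

abbreviation d_p :: "(point \<Rightarrow> real) \<Rightarrow> point \<Rightarrow> real" where
  "d_p \<equiv> partial_deriv (0, 0, 1)"

definition lift :: "(point \<Rightarrow> real) \<Rightarrow> jet \<Rightarrow> real" where
  "lift f = (\<lambda>(x, y, p, y2, y3, y4). f (x, y, p))"

(* The total derivative D, truncated after y'''' d/dy'''. It agrees with D on functions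
   that do not depend on y'''', and it is only applied to such functions below. *)
definition total_deriv :: "(jet \<Rightarrow> real) \<Rightarrow> jet \<Rightarrow> real" where
  "total_deriv F = (\<lambda>(x, y, p, y2, y3, y4).
     let j = (x, y, p, y2, y3, y4) in
       partial_deriv (1, 0, 0, 0, 0, 0) F j
       + p * partial_deriv (0, 1, 0, 0, 0, 0) F j
       + y2 * partial_deriv (0, 0, 1, 0, 0, 0) F j
       + y3 * partial_deriv (0, 0, 0, 1, 0, 0) F j
       + y4 * partial_deriv (0, 0, 0, 0, 1, 0) F j)"

(* u', u'', u''' for t = phi(x, y, y'), u = psi(x, y, y'). *)
definition u1 :: "(point \<Rightarrow> real) \<Rightarrow> (point \<Rightarrow> real) \<Rightarrow> jet \<Rightarrow> real" where
  "u1 \<phi> \<psi> j = total_deriv (lift \<psi>) j / total_deriv (lift \<phi>) j"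

definition u2 :: "(point \<Rightarrow> real) \<Rightarrow> (point \<Rightarrow> real) \<Rightarrow> jet \<Rightarrow> real" where
  "u2 \<phi> \<psi> j = total_deriv (u1 \<phi> \<psi>) j / total_deriv (lift \<phi>) j"

definition u3 :: "(point \<Rightarrow> real) \<Rightarrow> (point \<Rightarrow> real) \<Rightarrow> jet \<Rightarrow> real" where
  "u3 \<phi> \<psi> j = total_deriv (u2 \<phi> \<psi>) j / total_deriv (lift \<phi>) j"

definition transformed_lhs ::
  "(real \<Rightarrow> real) \<Rightarrow> (point \<Rightarrow> real) \<Rightarrow> (point \<Rightarrow> real) \<Rightarrow> jet \<Rightarrow> real" where
  "transformed_lhs \<alpha> \<phi> \<psi> j = u3 \<phi> \<psi> j + \<alpha> (lift \<phi> j) * lift \<psi> j"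

(* The transformed left-hand side is affine in y'''', so its coefficient of y'''' is its
   partial derivative with respect to y''''. *)
definition top_coeff ::
  "(real \<Rightarrow> real) \<Rightarrow> (point \<Rightarrow> real) \<Rightarrow> (point \<Rightarrow> real) \<Rightarrow> jet \<Rightarrow> real" where
  "top_coeff \<alpha> \<phi> \<psi> = partial_deriv (0, 0, 0, 0, 0, 1) (transformed_lhs \<alpha> \<phi> \<psi>)"

definition normalized_lhs ::
  "(real \<Rightarrow> real) \<Rightarrow> (point \<Rightarrow> real) \<Rightarrow> (point \<Rightarrow> real) \<Rightarrow> jet \<Rightarrow> real" where
  "normalized_lhs \<alpha> \<phi> \<psi> j = transformed_lhs \<alpha> \<phi> \<psi> j / top_coeff \<alpha> \<phi> \<psi> j"

(* The jets over U at which the quotients defining u', u'', u''' make sense. *)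
definition jet_domain :: "(point \<Rightarrow> real) \<Rightarrow> point set \<Rightarrow> jet set" where
  "jet_domain \<phi> U =
     {(x, y, p, y2, y3, y4). (x, y, p) \<in> U \<and> total_deriv (lift \<phi>) (x, y, p, y2, y3, y4) \<noteq> 0}"

end

theory Submission
  imports Defs
begin

text \<open>
  On functions of \<open>(x, y, p)\<close> the total derivative splits as
  \<open>D = (\<partial>\<^sub>x + p \<partial>\<^sub>y) + y'' \<partial>\<^sub>p\<close>. Hence \<open>M = D\<phi>\<close> and \<open>N = D\<psi>\<close> are linear
  in \<open>y''\<close>, and differentiating \<open>u' = N / M\<close> gives
  \<open>u'' = (w y''' + Q) / M\<^sup>3\<close>, where \<open>w\<close> is, up to sign, the non-contact determinant and \<open>Q\<close> is a
  cubic in \<open>y''\<close> with coefficients depending on \<open>x, y, p\<close>. One more differentiation shows that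
  \<open>w / M\<^sup>4\<close> is the coefficient of \<open>y''''\<close> in \<open>u'''\<close>, which cannot vanish, and that the normalized
  equation is \<open>y'''' + R / (w M) = 0\<close> with a single polynomial
  \<open>R = -3 w \<phi>\<^sub>p y'''\<^sup>2 + (g2 y''\<^sup>2 + g1 y'' + g0) y''' + (h5 y''\<^sup>5 + \<dots> + h0)\<close>
  (lemmas \<open>R_eq\<close> and \<open>normalized_lhs_eq\<close>). The coefficient of \<open>y'''\<close> in \<open>R\<close> could a priori be cubic
  in \<open>y''\<close>, but the two cubic contributions cancel.

  Both normal forms are read off from \<open>R / (w M)\<close>. If \<open>\<phi>\<^sub>p\<close> is nowhere zero, then
  \<open>M = \<phi>\<^sub>p (y'' + r)\<close> with \<open>r = (\<phi>\<^sub>x + p \<phi>\<^sub>y) / \<phi>\<^sub>p\<close>, and dividing the coefficients of \<open>R\<close> by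
  \<open>w \<phi>\<^sub>p\<close> gives the second form. If \<open>\<phi>\<^sub>p\<close> is identically zero, then \<open>M\<close> does not involve \<open>y''\<close>
  and \<open>g2\<close>, \<open>h4\<close>, \<open>h5\<close> vanish, which gives the first form.

  The coefficients involve at most third derivatives of \<open>\<phi>\<close> and \<open>\<psi>\<close> and the composite
  \<open>\<alpha> \<circ> \<phi>\<close>, so their regularity follows from the closure of the classes \<open>C\<^sup>n\<close> under arithmetic,
  partial derivatives and composition.
\<close>

section \<open>Calculus of the classes of smooth functions\<close>

lemma has_derivative_imp_partial_deriv:
  assumes "(f has_derivative f') (at z)"
  shows "partial_deriv b f z = f' b"
proof -
  have "((\<lambda>s. z + s *\<^sub>R b) has_derivative (\<lambda>s. s *\<^sub>R b)) (at 0)"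
    by (auto intro!: derivative_eq_intros)
  moreover have "(f has_derivative f') (at (z + 0 *\<^sub>R b))"
    using assms by simp
  ultimately have "((\<lambda>s. f (z + s *\<^sub>R b)) has_derivative (\<lambda>s. f' (s *\<^sub>R b))) (at 0)"
    by (rule has_derivative_compose[where f = "\<lambda>s. z + s *\<^sub>R b"])
  moreover have "(\<lambda>s. f' (s *\<^sub>R b)) = (\<lambda>s. f' b * s)"
    using has_derivative_linear[OF assms] by (auto simp: linear_cmul)
  ultimately show ?thesis
    unfolding partial_deriv_def
    by (intro DERIV_imp_deriv) (simp add: has_field_derivative_def)
qed

lemma partial_deriv_cong_open:
  assumes "open S" "z \<in> S" "\<And>x. x \<in> S \<Longrightarrow> f x = g x"
  shows "partial_deriv b f z = partial_deriv b g z"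
proof -
  have "isCont (\<lambda>s. z + s *\<^sub>R b) 0"
    by simp
  then have "((\<lambda>s. z + s *\<^sub>R b) \<longlongrightarrow> z) (nhds 0)"
    using tendsto_at_iff_tendsto_nhds[of "\<lambda>s. z + s *\<^sub>R b" 0] by (simp add: isCont_def)
  then have "eventually (\<lambda>s. z + s *\<^sub>R b \<in> S) (nhds 0)"
    using assms(1,2) by (rule topological_tendstoD)
  then have "eventually (\<lambda>s. f (z + s *\<^sub>R b) = g (z + s *\<^sub>R b)) (nhds 0)"
    by (rule eventually_mono) (rule assms(3))
  then show ?thesis
    unfolding partial_deriv_def by (intro deriv_cong_ev) auto
qed

lemma C_k_on_Suc_differentiable:
  assumes "open S" "C_k_on (Suc n) S f" "z \<in> S"
  shows "f differentiable (at z)"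
  using assms(2,3) at_within_open[OF assms(3,1)] by (auto simp: differentiable_on_def)

lemma C_k_on_cong:
  assumes "open S" "\<And>x. x \<in> S \<Longrightarrow> f x = g x" "C_k_on n S f"
  shows "C_k_on n S g"
  using assms(2,3)
proof (induction n arbitrary: f g)
  case 0
  then show ?case using continuous_on_cong[of S S f g] by simp
next
  case (Suc n)
  have "g differentiable (at z)" if z: "z \<in> S" for z
  proof -
    obtain f' where "(f has_derivative f') (at z)"
      using C_k_on_Suc_differentiable[OF assms(1) Suc.prems(2) z] by (auto simp: differentiable_def)
    then have "(g has_derivative f') (at z)"
      using assms(1) z Suc.prems(1) by (rule has_derivative_transform_within_open)
    then show ?thesis by (auto simp: differentiable_def)
  qed
  then have "g differentiable_on S"
    by (simp add: differentiable_at_imp_differentiable_on)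
  moreover have "C_k_on n S (partial_deriv b g)" if "b \<in> Basis" for b
  proof (rule Suc.IH)
    show "C_k_on n S (partial_deriv b f)" using Suc.prems(2) that by simp
    show "partial_deriv b f x = partial_deriv b g x" if "x \<in> S" for x
      using assms(1) that Suc.prems(1) by (rule partial_deriv_cong_open)
  qed
  ultimately show ?case by simp
qed

lemma C_k_on_SucD: "C_k_on (Suc n) S f \<Longrightarrow> C_k_on n S f"
  by (induction n arbitrary: f) (auto intro: differentiable_imp_continuous_on)

lemma C_k_on_mono: "C_k_on m S f \<Longrightarrow> n \<le> m \<Longrightarrow> C_k_on n S f"
proof (induction m)
  case (Suc m)
  then show ?case using C_k_on_SucD[of m S f] by (cases "n = Suc m") (auto simp del: C_k_on.simps)
qed simp

lemma C_k_on_Suc_has_derivative: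
  assumes "open S" "C_k_on (Suc n) S f" "z \<in> S"
  shows "(f has_derivative (\<lambda>v. partial_deriv v f z)) (at z)"
proof -
  obtain f' where f': "(f has_derivative f') (at z)"
    using C_k_on_Suc_differentiable[OF assms] by (auto simp: differentiable_def)
  then have "f' = (\<lambda>v. partial_deriv v f z)"
    using has_derivative_imp_partial_deriv by fastforce
  with f' show ?thesis by simp
qed

lemma C_k_on_partial_deriv: "C_k_on (Suc n) S f \<Longrightarrow> b \<in> Basis \<Longrightarrow> C_k_on n S (partial_deriv b f)"
  by simp

text \<open>An explicit candidate for the derivative reduces membership in the next class to
  membership of the directional derivatives; the closure properties below are inductions
  on this step.\<close>

lemma C_k_on_SucI:
  assumes "open S"
    and "\<And>z. z \<in> S \<Longrightarrow> (f has_derivative f' z) (at z)"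
    and "\<And>b. b \<in> Basis \<Longrightarrow> C_k_on n S (\<lambda>z. f' z b)"
  shows "C_k_on (Suc n) S f"
proof -
  have "C_k_on n S (partial_deriv b f)" if "b \<in> Basis" for b
  proof (rule C_k_on_cong[OF assms(1) _ assms(3)[OF that]])
    show "f' z b = partial_deriv b f z" if "z \<in> S" for z
      using has_derivative_imp_partial_deriv[OF assms(2)[OF that]] by simp
  qed
  moreover have "f differentiable_on S"
    using assms(2) by (intro differentiable_at_imp_differentiable_on) (auto simp: differentiable_def)
  ultimately show ?thesis by simp
qed

lemma C_k_on_const: "open S \<Longrightarrow> C_k_on n S (\<lambda>z. c)"
proof (induction n arbitrary: c)
  case (Suc n)
  show ?case
    by (rule C_k_on_SucI[where f' = "\<lambda>z v. 0"]) (use Suc in auto)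
qed simp

lemma C_k_on_bounded_linear:
  assumes "open S" "bounded_linear f"
  shows "C_k_on n S f"
proof (cases n)
  case 0
  then show ?thesis using assms by (simp add: linear_continuous_on)
next
  case (Suc m)
  show ?thesis unfolding Suc
    by (rule C_k_on_SucI[where f' = "\<lambda>z. f"])
       (use assms bounded_linear_imp_has_derivative C_k_on_const in auto)
qed

lemma C_k_on_add:
  assumes "open S" "C_k_on n S f" "C_k_on n S g"
  shows "C_k_on n S (\<lambda>z. f z + g z)"
  using assms(2,3)
proof (induction n arbitrary: f g)
  case 0
  then show ?case by (simp add: continuous_on_add)
next
  case (Suc n)
  show ?case
  proof (rule C_k_on_SucI[OF assms(1)])
    show "((\<lambda>z. f z + g z) has_derivative (\<lambda>v. partial_deriv v f z + partial_deriv v g z)) (at z)"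
      if "z \<in> S" for z
      using Suc.prems that assms(1) by (intro has_derivative_add C_k_on_Suc_has_derivative)
  qed (use Suc in simp)
qed

lemma C_k_on_mult:
  assumes "open S" "C_k_on n S f" "C_k_on n S g"
  shows "C_k_on n S (\<lambda>z. f z * g z)"
  using assms(2,3)
proof (induction n arbitrary: f g)
  case 0
  then show ?case by (simp add: continuous_on_mult)
next
  case (Suc n)
  show ?case
  proof (rule C_k_on_SucI[OF assms(1)])
    show "((\<lambda>z. f z * g z) has_derivative
        (\<lambda>v. f z * partial_deriv v g z + partial_deriv v f z * g z)) (at z)"
      if "z \<in> S" for z
      using Suc.prems that assms(1) by (intro has_derivative_mult C_k_on_Suc_has_derivative)
  next
    fix b :: 'a assume "b \<in> Basis"
    then show "C_k_on n S (\<lambda>z. f z * partial_deriv b g z + partial_deriv b f z * g z)"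
      using Suc.prems Suc.prems[THEN C_k_on_SucD]
      by (intro C_k_on_add[OF assms(1)] Suc.IH C_k_on_partial_deriv)
  qed
qed

lemma C_k_on_diff:
  assumes "open S" "C_k_on n S f" "C_k_on n S g"
  shows "C_k_on n S (\<lambda>z. f z - g z)"
  using C_k_on_add[OF assms(1,2) C_k_on_mult[OF assms(1) C_k_on_const[OF assms(1), of n "-1"] assms(3)]]
  by simp

lemma C_k_on_power:
  assumes "open S" "C_k_on n S f"
  shows "C_k_on n S (\<lambda>z. f z ^ m)"
  by (induction m) (simp_all add: C_k_on_const C_k_on_mult assms del: C_k_on.simps)

lemma C_k_on_inverse:
  assumes "open S" "C_k_on n S f" "\<And>z. z \<in> S \<Longrightarrow> f z \<noteq> 0"
  shows "C_k_on n S (\<lambda>z. inverse (f z))"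
  using assms(2)
proof (induction n)
  case 0
  then show ?case using assms(3) by (simp add: continuous_on_inverse)
next
  case (Suc n)
  note inv = Suc.IH[OF C_k_on_SucD[OF Suc.prems]]
  show ?case
  proof (rule C_k_on_SucI[OF assms(1)])
    show "((\<lambda>z. inverse (f z)) has_derivative
        (\<lambda>v. (- 1) * (inverse (f z) * partial_deriv v f z * inverse (f z)))) (at z)"
      \<comment> \<open>Written with \<open>inverse (f z)\<close> rather than \<open>1 / f\<^sup>2\<close>, so that the induction hypothesis applies
        to the factors.\<close>
      if "z \<in> S" for z
      using Deriv.has_derivative_inverse[OF assms(3)[OF that]
          C_k_on_Suc_has_derivative[OF assms(1) Suc.prems that]] by simp
  next
    fix b :: 'a assume "b \<in> Basis"
    then show "C_k_on n S (\<lambda>z. (- 1) * (inverse (f z) * partial_deriv b f z * inverse (f z)))"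
      using Suc.prems inv by (intro C_k_on_mult[OF assms(1)] C_k_on_const[OF assms(1)]
        C_k_on_partial_deriv)
  qed
qed

lemma C_k_on_divide:
  assumes "open S" "C_k_on n S f" "C_k_on n S g" "\<And>z. z \<in> S \<Longrightarrow> g z \<noteq> 0"
  shows "C_k_on n S (\<lambda>z. f z / g z)"
  unfolding divide_inverse using assms by (intro C_k_on_mult C_k_on_inverse)

lemma C_k_on_compose:
  fixes h :: "real \<Rightarrow> real"
  assumes "open S" "open T" "f ` S \<subseteq> T" "C_k_on n S f" "C_k_on n T h"
  shows "C_k_on n S (\<lambda>z. h (f z))"
  using assms(4,5)
proof (induction n arbitrary: h)
  case 0
  then show ?case using continuous_on_compose2[OF _ _ assms(3)] by simp
next
  case (Suc n)
  show ?case
  proof (rule C_k_on_SucI[OF assms(1)])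
    fix z assume z: "z \<in> S"
    let ?h' = "\<lambda>v. partial_deriv v h (f z)"
    have h': "(h has_derivative ?h') (at (f z))"
      using C_k_on_Suc_has_derivative[OF assms(2) Suc.prems(2)] assms(3) z by blast
    have "?h' v = partial_deriv 1 h (f z) * v" for v
      using linear_cmul[OF has_derivative_linear[OF h'], of v 1] by simp
    then have "?h' = (\<lambda>v. partial_deriv 1 h (f z) * v)"
      by (rule ext)
    then have "(h has_derivative (\<lambda>v. partial_deriv 1 h (f z) * v)) (at (f z))"
      using h' by (simp only:)
    then show "((\<lambda>z. h (f z)) has_derivative
        (\<lambda>v. partial_deriv 1 h (f z) * partial_deriv v f z)) (at z)"
      by (rule has_derivative_compose[OF C_k_on_Suc_has_derivative[OF assms(1) Suc.prems(1) z]])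
  next
    fix b :: 'a assume "b \<in> Basis"
    then show "C_k_on n S (\<lambda>z. partial_deriv 1 h (f z) * partial_deriv b f z)"
      using C_k_on_mult[OF assms(1) Suc.IH[OF C_k_on_SucD[OF Suc.prems(1)]]
          C_k_on_partial_deriv[OF Suc.prems(1)]] C_k_on_partial_deriv[OF Suc.prems(2), of 1]
      by simp
  qed
qed

section \<open>The total derivative on jets\<close>

definition base :: "jet \<Rightarrow> point" where
  "base = (\<lambda>(x, y, p, y2, y3, y4). (x, y, p))"

definition jet_p :: "jet \<Rightarrow> real" where
  "jet_p = (\<lambda>(x, y, p, y2, y3, y4). p)"

definition jet_y2 :: "jet \<Rightarrow> real" where
  "jet_y2 = (\<lambda>(x, y, p, y2, y3, y4). y2)"

definition jet_y3 :: "jet \<Rightarrow> real" where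
  "jet_y3 = (\<lambda>(x, y, p, y2, y3, y4). y3)"

definition jet_y4 :: "jet \<Rightarrow> real" where
  "jet_y4 = (\<lambda>(x, y, p, y2, y3, y4). y4)"

lemmas jet_coordinate_defs = base_def jet_p_def jet_y2_def jet_y3_def jet_y4_def

lemma jet_coordinates [simp]:
  "base (x, y, p, y2, y3, y4) = (x, y, p)"
  "jet_p (x, y, p, y2, y3, y4) = p"
  "jet_y2 (x, y, p, y2, y3, y4) = y2"
  "jet_y3 (x, y, p, y2, y3, y4) = y3"
  "jet_y4 (x, y, p, y2, y3, y4) = y4"
  by (simp_all add: jet_coordinate_defs)

lemma lift_eq_base: "lift f j = f (base j)"
  by (cases j) (simp add: lift_def)

lemma bounded_linear_jet_coordinates:
  "bounded_linear base" "bounded_linear jet_p" "bounded_linear jet_y2"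
  "bounded_linear jet_y3" "bounded_linear jet_y4"
  by (auto simp: linear_conv_bounded_linear[symmetric] linear_iff jet_coordinate_defs)

text \<open>The tangent vector along which \<open>D\<close> differentiates. The last component is \<open>0\<close> because \<open>D\<close> is
  only applied to functions that do not depend on \<open>y''''\<close>.\<close>

definition total_dir :: "jet \<Rightarrow> jet" where
  "total_dir j = (1, jet_p j, jet_y2 j, jet_y3 j, jet_y4 j, 0)"

text \<open>For a differentiable function the total derivative is the derivative in one direction,
  so it obeys the product and quotient rules. Bundling differentiability with the value lets
  these rules be chained without separate differentiability side conditions.\<close>

definition has_total_deriv :: "(jet \<Rightarrow> real) \<Rightarrow> real \<Rightarrow> jet \<Rightarrow> bool" where
  "has_total_deriv F v j \<longleftrightarrow> (\<exists>F'. (F has_derivative F') (at j) \<and> F' (total_dir j) = v)"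

lemma has_total_deriv_imp_total_deriv:
  assumes "has_total_deriv F v j"
  shows "total_deriv F j = v"
proof -
  obtain F' where F': "(F has_derivative F') (at j)" "F' (total_dir j) = v"
    using assms by (auto simp: has_total_deriv_def)
  obtain x y p y2 y3 y4 where j: "j = (x, y, p, y2, y3, y4)" by (cases j)
  have lin: "linear F'" using F'(1) by (rule has_derivative_linear)
  have "total_dir j = (1,0,0,0,0,0) + p *\<^sub>R (0,1,0,0,0,0) + y2 *\<^sub>R (0,0,1,0,0,0)
      + y3 *\<^sub>R (0,0,0,1,0,0) + y4 *\<^sub>R (0,0,0,0,1,0)"
    by (simp add: total_dir_def j)
  then have "F' (total_dir j) = F' (1,0,0,0,0,0) + p * F' (0,1,0,0,0,0) + y2 * F' (0,0,1,0,0,0)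
      + y3 * F' (0,0,0,1,0,0) + y4 * F' (0,0,0,0,1,0)"
    by (simp only: linear_add[OF lin] linear_cmul[OF lin] real_scaleR_def)
  then show ?thesis
    using F' has_derivative_imp_partial_deriv[OF F'(1)] by (simp add: total_deriv_def j Let_def)
qed

lemma has_total_deriv_eq: "has_total_deriv F v j \<Longrightarrow> v = w \<Longrightarrow> has_total_deriv F w j"
  by simp

lemma has_total_deriv_add:
  assumes "has_total_deriv F v j" "has_total_deriv G w j"
  shows "has_total_deriv (\<lambda>j. F j + G j) (v + w) j"
proof -
  obtain F' G' where F': "(F has_derivative F') (at j)" "F' (total_dir j) = v"
    and G': "(G has_derivative G') (at j)" "G' (total_dir j) = w"
    using assms by (auto simp: has_total_deriv_def)
  show ?thesis
    unfolding has_total_deriv_def using has_derivative_add[OF F'(1) G'(1)] F'(2) G'(2) by auto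
qed

lemma has_total_deriv_mult:
  assumes "has_total_deriv F v j" "has_total_deriv G w j"
  shows "has_total_deriv (\<lambda>j. F j * G j) (F j * w + v * G j) j"
proof -
  obtain F' G' where F': "(F has_derivative F') (at j)" "F' (total_dir j) = v"
    and G': "(G has_derivative G') (at j)" "G' (total_dir j) = w"
    using assms by (auto simp: has_total_deriv_def)
  show ?thesis
    unfolding has_total_deriv_def using has_derivative_mult[OF F'(1) G'(1)] F'(2) G'(2) by auto
qed

lemma has_total_deriv_power:
  assumes "has_total_deriv F v j"
  shows "has_total_deriv (\<lambda>j. F j ^ n) (real n * F j ^ (n - 1) * v) j"
proof -
  obtain F' where F': "(F has_derivative F') (at j)" "F' (total_dir j) = v"
    using assms by (auto simp: has_total_deriv_def)
  have "((\<lambda>j. F j ^ n) has_derivative (\<lambda>h. real n * F' h * F j ^ (n - 1))) (at j)"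
    using has_derivative_power[OF F'(1)] by simp
  then show ?thesis unfolding has_total_deriv_def using F'(2) by (auto simp: mult_ac)
qed

lemma has_total_deriv_divide:
  assumes "has_total_deriv F v j" "has_total_deriv G w j" "G j \<noteq> 0"
  shows "has_total_deriv (\<lambda>j. F j / G j) ((v * G j - F j * w) / (G j)\<^sup>2) j"
proof -
  obtain F' G' where F': "(F has_derivative F') (at j)" "F' (total_dir j) = v"
    and G': "(G has_derivative G') (at j)" "G' (total_dir j) = w"
    using assms(1,2) by (auto simp: has_total_deriv_def)
  show ?thesis
    unfolding has_total_deriv_def
    using has_derivative_divide'[OF F'(1) G'(1) assms(3)] F'(2) G'(2)
    by (auto simp: power2_eq_square)
qed

lemma has_total_deriv_jet_y2: "has_total_deriv jet_y2 (jet_y3 j) j"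
  and has_total_deriv_jet_y3: "has_total_deriv jet_y3 (jet_y4 j) j"
  unfolding has_total_deriv_def
  using bounded_linear_imp_has_derivative[OF bounded_linear_jet_coordinates(3)]
    bounded_linear_imp_has_derivative[OF bounded_linear_jet_coordinates(4)]
  by (fastforce simp: total_dir_def)+

text \<open>The part \<open>\<partial>\<^sub>x + p \<partial>\<^sub>y\<close> of \<open>D\<close> that does not raise the order of a function of \<open>x, y, p\<close>.\<close>

definition d_xy :: "(point \<Rightarrow> real) \<Rightarrow> point \<Rightarrow> real" where
  "d_xy f z = d_x f z + snd (snd z) * d_y f z"

lemma C_k_on_d_xy:
  assumes "open S" "C_k_on (Suc n) S f"
  shows "C_k_on n S (d_xy f)"
proof -
  have "C_k_on n S (\<lambda>z. snd (snd z))"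
    by (intro C_k_on_bounded_linear assms bounded_linear_compose[OF bounded_linear_snd]
        bounded_linear_snd)
  then show ?thesis
    unfolding d_xy_def[abs_def] using assms
    by (intro C_k_on_add C_k_on_mult C_k_on_partial_deriv) (auto simp: Basis_prod_def zero_prod_def)
qed

lemma C_k_on_d_p: "C_k_on (Suc n) S f \<Longrightarrow> C_k_on n S (d_p f)"
  by (intro C_k_on_partial_deriv) (auto simp: Basis_prod_def zero_prod_def)

text \<open>The splitting of \<open>D\<close> on functions of \<open>x, y, p\<close>, which is the source of every power of \<open>y''\<close>
  in the transformed equation.\<close>

lemma has_total_deriv_base:
  assumes "f differentiable (at (base j))"
  shows "has_total_deriv (\<lambda>j. f (base j)) (d_xy f (base j) + jet_y2 j * d_p f (base j)) j"
proof -
  obtain f' where f': "(f has_derivative f') (at (base j))"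
    using assms by (auto simp: differentiable_def)
  have lin: "linear f'" using f' by (rule has_derivative_linear)
  have "base (total_dir j) = (1,0,0) + snd (snd (base j)) *\<^sub>R (0,1,0) + jet_y2 j *\<^sub>R (0,0,1)"
    by (cases j) (simp add: total_dir_def)
  then have "f' (base (total_dir j)) = f' (1,0,0) + snd (snd (base j)) * f' (0,1,0)
      + jet_y2 j * f' (0,0,1)"
    by (simp only: linear_add[OF lin] linear_cmul[OF lin] real_scaleR_def)
  then have "f' (base (total_dir j)) = d_xy f (base j) + jet_y2 j * d_p f (base j)"
    by (simp add: d_xy_def has_derivative_imp_partial_deriv[OF f'])
  moreover have "((\<lambda>j. f (base j)) has_derivative (\<lambda>v. f' (base v))) (at j)"
    using bounded_linear_imp_has_derivative[OF bounded_linear_jet_coordinates(1)] f'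
    by (rule has_derivative_compose)
  ultimately show ?thesis unfolding has_total_deriv_def by blast
qed

text \<open>The explicit formulas for \<open>u'\<close> and \<open>u''\<close> hold on open sets of jets only; that is enough
  to differentiate them.\<close>

lemma has_total_deriv_transform_open:
  assumes "has_total_deriv F v j" "open S" "j \<in> S" "\<And>i. i \<in> S \<Longrightarrow> F i = G i"
  shows "has_total_deriv G v j"
proof -
  obtain F' where F': "(F has_derivative F') (at j)" "F' (total_dir j) = v"
    using assms(1) by (auto simp: has_total_deriv_def)
  have "(G has_derivative F') (at j)"
    using F'(1) assms(2-4) by (rule has_derivative_transform_within_open)
  then show ?thesis using F'(2) by (auto simp: has_total_deriv_def)
qed

section \<open>The transformed equation\<close>

locale tangent_transformation =
  fixes \<alpha> :: "real \<Rightarrow> real" and \<phi> \<psi> :: "point \<Rightarrow> real"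
    and U :: "point set" and T :: "real set" and k :: nat
  assumes open_U: "open U" and open_T: "open T" and \<phi>_into_T: "\<phi> ` U \<subseteq> T"
    and smooth_\<phi>: "C_k_on (k + 3) U \<phi>" and smooth_\<psi>: "C_k_on (k + 3) U \<psi>"
    and smooth_\<alpha>: "C_k_on k T \<alpha>"
    and non_contact: "z \<in> U \<Longrightarrow> d_xy \<phi> z * d_p \<psi> z - d_p \<phi> z * d_xy \<psi> z \<noteq> 0"
begin

text \<open>A digit in a name counts powers of \<open>y''\<close>: the coefficient of \<open>y''\<^sup>i\<close> in a polynomial carries
  the digit \<open>i\<close>. The argument \<open>s\<close> stands for \<open>y''\<close>.\<close>

definition "\<phi>0 = d_xy \<phi>"
definition "\<phi>1 = d_p \<phi>"
definition "\<psi>0 = d_xy \<psi>"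
definition "\<psi>1 = d_p \<psi>"

definition "M z s = \<phi>0 z + \<phi>1 z * s"
definition "N z s = \<psi>0 z + \<psi>1 z * s"

text \<open>The determinant whose vanishing characterises contact transformations. It is also
  \<open>M \<psi>\<^sub>p - N \<phi>\<^sub>p\<close>, in which \<open>y''\<close> cancels.\<close>

definition "w z = \<phi>0 z * \<psi>1 z - \<phi>1 z * \<psi>0 z"

definition "m0 = d_xy \<phi>0"
definition "m1 z = d_p \<phi>0 z + d_xy \<phi>1 z"
definition "m2 = d_p \<phi>1"
definition "n0 = d_xy \<psi>0"
definition "n1 z = d_p \<psi>0 z + d_xy \<psi>1 z"
definition "n2 = d_p \<psi>1"

text \<open>\<open>DM = M' + \<phi>1 y'''\<close> and \<open>DN = N' + \<psi>1 y'''\<close>.\<close>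

definition "M' z s = m0 z + m1 z * s + m2 z * s ^ 2"
definition "N' z s = n0 z + n1 z * s + n2 z * s ^ 2"

text \<open>\<open>Q = M N' - N M'\<close>, the part of the numerator of \<open>D(N / M)\<close> that is free of \<open>y'''\<close>.\<close>

definition "q0 z = \<phi>0 z * n0 z - \<psi>0 z * m0 z"
definition "q1 z = \<phi>0 z * n1 z + \<phi>1 z * n0 z - \<psi>0 z * m1 z - \<psi>1 z * m0 z"
definition "q2 z = \<phi>0 z * n2 z + \<phi>1 z * n1 z - \<psi>0 z * m2 z - \<psi>1 z * m1 z"
definition "q3 z = \<phi>1 z * n2 z - \<psi>1 z * m2 z"

definition "Q z s = q0 z + q1 z * s + q2 z * s ^ 2 + q3 z * s ^ 3"

definition "e0 = d_xy q0"
definition "e1 z = d_p q0 z + d_xy q1 z"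
definition "e2 z = d_p q1 z + d_xy q2 z"
definition "e3 z = d_p q2 z + d_xy q3 z"
definition "e4 = d_p q3"

text \<open>\<open>DQ = Q' + Q_s y'''\<close> with \<open>Q_s\<close> the derivative of \<open>Q\<close> in its second argument.\<close>

definition "Q' z s = e0 z + e1 z * s + e2 z * s ^ 2 + e3 z * s ^ 3 + e4 z * s ^ 4"
definition "Q_s z s = q1 z + 2 * q2 z * s + 3 * q3 z * s ^ 2"

text \<open>\<open>Dw = w0 + w1 y''\<close>.\<close>

definition "w0 = d_xy w"
definition "w1 = d_p w"

text \<open>The term \<open>\<alpha>(t) u\<close> in the new variables.\<close>

definition "\<beta> z = \<alpha> (\<phi> z) * \<psi> z"

text \<open>The coefficients, by powers of \<open>y''\<close>, of the term linear in \<open>y'''\<close> in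
  \<open>M (Dw y''' + DQ) - 3 (w y''' + Q) DM + \<beta> M\<^sup>5\<close>. There is no \<open>g3\<close>: the terms \<open>3 \<phi>1 q3\<close> coming
  from \<open>M Q_s\<close> and \<open>-3 \<phi>1 q3\<close> coming from \<open>-3 Q \<phi>1\<close> cancel.\<close>

definition "g0 z = \<phi>0 z * (w0 z + q1 z) - 3 * w z * m0 z - 3 * \<phi>1 z * q0 z"
definition "g1 z = \<phi>0 z * (w1 z + 2 * q2 z) + \<phi>1 z * (w0 z + q1 z)
  - 3 * w z * m1 z - 3 * \<phi>1 z * q1 z"
definition "g2 z = 3 * \<phi>0 z * q3 z + \<phi>1 z * (w1 z + 2 * q2 z)
  - 3 * w z * m2 z - 3 * \<phi>1 z * q2 z"

text \<open>The coefficients of the part of the same expression that is free of \<open>y'''\<close>, namely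
  \<open>M Q' - 3 Q M' + \<beta> M\<^sup>5\<close>.\<close>

definition "h0 z = \<phi>0 z * e0 z - 3 * (q0 z * m0 z) + \<beta> z * \<phi>0 z ^ 5"
definition "h1 z = \<phi>0 z * e1 z + \<phi>1 z * e0 z - 3 * (q0 z * m1 z + q1 z * m0 z)
  + 5 * \<beta> z * \<phi>0 z ^ 4 * \<phi>1 z"
definition "h2 z = \<phi>0 z * e2 z + \<phi>1 z * e1 z - 3 * (q0 z * m2 z + q1 z * m1 z + q2 z * m0 z)
  + 10 * \<beta> z * \<phi>0 z ^ 3 * \<phi>1 z ^ 2"
definition "h3 z = \<phi>0 z * e3 z + \<phi>1 z * e2 z - 3 * (q1 z * m2 z + q2 z * m1 z + q3 z * m0 z)
  + 10 * \<beta> z * \<phi>0 z ^ 2 * \<phi>1 z ^ 3"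
definition "h4 z = \<phi>0 z * e4 z + \<phi>1 z * e3 z - 3 * (q2 z * m2 z + q3 z * m1 z)
  + 5 * \<beta> z * \<phi>0 z * \<phi>1 z ^ 4"
definition "h5 z = \<phi>1 z * e4 z - 3 * (q3 z * m2 z) + \<beta> z * \<phi>1 z ^ 5"

lemma w_nonzero: "z \<in> U \<Longrightarrow> w z \<noteq> 0"
  using non_contact by (simp add: w_def \<phi>0_def \<phi>1_def \<psi>0_def \<psi>1_def)

lemma Q_eq: "Q z s = M z s * N' z s - N z s * M' z s"
  unfolding Q_def M_def N_def M'_def N'_def q0_def q1_def q2_def q3_def
  by (simp add: algebra_simps power2_eq_square power3_eq_cube)

lemma w_eq: "w z = M z s * \<psi>1 z - N z s * \<phi>1 z"
  by (simp add: w_def M_def N_def algebra_simps)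

subsection \<open>Regularity of the coefficients\<close>

text \<open>Each application of \<open>D\<close> costs one derivative, so the three derivatives in \<open>u'''\<close> lead from
  class \<open>k + 3\<close> down to class \<open>k\<close>.\<close>

lemmas C_k_on_U_arith =
  C_k_on_add[OF open_U] C_k_on_diff[OF open_U] C_k_on_mult[OF open_U]
  C_k_on_power[OF open_U] C_k_on_const[OF open_U]

lemma smooth3: "C_k_on (Suc (Suc (Suc k))) U \<phi>" "C_k_on (Suc (Suc (Suc k))) U \<psi>"
  using smooth_\<phi> smooth_\<psi> by (simp_all only: numeral_3_eq_3 add_Suc_right add_0_right)

lemma smooth2:
  "C_k_on (Suc (Suc k)) U \<phi>0" "C_k_on (Suc (Suc k)) U \<phi>1"
  "C_k_on (Suc (Suc k)) U \<psi>0" "C_k_on (Suc (Suc k)) U \<psi>1"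
  unfolding \<phi>0_def \<phi>1_def \<psi>0_def \<psi>1_def
  by (intro C_k_on_d_xy[OF open_U] C_k_on_d_p smooth3)+

lemmas smooth1' = smooth2[THEN C_k_on_SucD]

lemma smooth1:
  "C_k_on (Suc k) U m0" "C_k_on (Suc k) U m1" "C_k_on (Suc k) U m2"
  "C_k_on (Suc k) U n0" "C_k_on (Suc k) U n1" "C_k_on (Suc k) U n2"
  "C_k_on (Suc k) U w"
  unfolding m0_def m1_def[abs_def] m2_def n0_def n1_def[abs_def] n2_def w_def[abs_def]
  by (intro C_k_on_d_xy[OF open_U] C_k_on_d_p C_k_on_U_arith smooth2 smooth1')+

lemma smooth1_q:
  "C_k_on (Suc k) U q0" "C_k_on (Suc k) U q1" "C_k_on (Suc k) U q2" "C_k_on (Suc k) U q3"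
  unfolding q0_def[abs_def] q1_def[abs_def] q2_def[abs_def] q3_def[abs_def]
  by (intro C_k_on_U_arith smooth1 smooth1')+

lemma smooth0_e:
  "C_k_on k U e0" "C_k_on k U e1" "C_k_on k U e2" "C_k_on k U e3" "C_k_on k U e4"
  "C_k_on k U w0" "C_k_on k U w1"
  unfolding e0_def e1_def[abs_def] e2_def[abs_def] e3_def[abs_def] e4_def w0_def w1_def
  by (intro C_k_on_d_xy[OF open_U] C_k_on_d_p C_k_on_U_arith smooth1 smooth1_q)+

lemma smooth_\<beta>: "C_k_on k U \<beta>"
proof -
  have "C_k_on k U \<phi>" "C_k_on k U \<psi>"
    by (rule C_k_on_mono[OF smooth_\<phi>], simp) (rule C_k_on_mono[OF smooth_\<psi>], simp)
  then show ?thesis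
    unfolding \<beta>_def[abs_def]
    using C_k_on_compose[OF open_U open_T \<phi>_into_T _ smooth_\<alpha>] by (intro C_k_on_mult[OF open_U])
qed

lemmas smooth0 = smooth1'[THEN C_k_on_SucD] smooth1[THEN C_k_on_SucD] smooth1_q[THEN C_k_on_SucD]
  smooth0_e smooth_\<beta>

lemma smooth_coefficients:
  "C_k_on k U g0" "C_k_on k U g1" "C_k_on k U g2"
  "C_k_on k U h0" "C_k_on k U h1" "C_k_on k U h2"
  "C_k_on k U h3" "C_k_on k U h4" "C_k_on k U h5"
  unfolding g0_def[abs_def] g1_def[abs_def] g2_def[abs_def] h0_def[abs_def] h1_def[abs_def]
    h2_def[abs_def] h3_def[abs_def] h4_def[abs_def] h5_def[abs_def]
  by (intro C_k_on_U_arith smooth0)+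

lemma differentiable_U:
  "C_k_on (Suc n) U f \<Longrightarrow> base j \<in> U \<Longrightarrow> f differentiable (at (base j))"
  using C_k_on_Suc_differentiable[OF open_U] .

subsection \<open>The transformed derivatives\<close>

lemma total_deriv_lift:
  assumes "C_k_on (Suc n) U f" "base j \<in> U"
  shows "total_deriv (lift f) j = d_xy f (base j) + d_p f (base j) * jet_y2 j"
  using has_total_deriv_imp_total_deriv[OF has_total_deriv_base[OF differentiable_U[OF assms]]]
  by (simp add: lift_eq_base[abs_def] mult.commute)

lemma total_deriv_\<phi>: "base j \<in> U \<Longrightarrow> total_deriv (lift \<phi>) j = M (base j) (jet_y2 j)"
  by (simp add: total_deriv_lift[OF smooth3(1)] M_def \<phi>0_def \<phi>1_def)

lemma total_deriv_\<psi>: "base j \<in> U \<Longrightarrow> total_deriv (lift \<psi>) j = N (base j) (jet_y2 j)"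
  by (simp add: total_deriv_lift[OF smooth3(2)] N_def \<psi>0_def \<psi>1_def)

lemma jet_domain_iff: "j \<in> jet_domain \<phi> U \<longleftrightarrow> base j \<in> U \<and> M (base j) (jet_y2 j) \<noteq> 0"
proof -
  have "j \<in> jet_domain \<phi> U \<longleftrightarrow> base j \<in> U \<and> total_deriv (lift \<phi>) j \<noteq> 0"
    by (cases j) (simp add: jet_domain_def)
  then show ?thesis using total_deriv_\<phi>[of j] by auto
qed

lemma open_base_U: "open {j. base j \<in> U}"
  using open_vimage[OF open_U linear_continuous_on[OF bounded_linear_jet_coordinates(1)]]
  by (simp add: vimage_def)

lemma open_jet_domain: "open (jet_domain \<phi> U)"
proof -
  have "continuous_on U \<phi>0" "continuous_on U \<phi>1"
    using smooth2[THEN C_k_on_mono, of 0] by auto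
  note base = this[THEN continuous_on_compose2[OF _ linear_continuous_on[OF bounded_linear_jet_coordinates(1)]]]
  have "continuous_on {j. base j \<in> U} (\<lambda>j. M (base j) (jet_y2 j))"
    unfolding M_def
    by (intro continuous_on_add continuous_on_mult
      linear_continuous_on[OF bounded_linear_jet_coordinates(3)] base)
       auto
  then have "open ({j. base j \<in> U} \<inter> (\<lambda>j. M (base j) (jet_y2 j)) -` (- {0}))"
    using open_base_U by (rule continuous_open_preimage) auto
  moreover have "jet_domain \<phi> U = {j. base j \<in> U} \<inter> (\<lambda>j. M (base j) (jet_y2 j)) -` (- {0})"
    by (auto simp: jet_domain_iff)
  ultimately show ?thesis by simp
qed

lemma has_total_deriv_M:
  assumes "base j \<in> U"
  shows "has_total_deriv (\<lambda>j. M (base j) (jet_y2 j))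
    (M' (base j) (jet_y2 j) + \<phi>1 (base j) * jet_y3 j) j"
  unfolding M_def
  by (rule has_total_deriv_eq, (rule has_total_deriv_add has_total_deriv_mult has_total_deriv_jet_y2
      has_total_deriv_base differentiable_U[OF smooth2(1)] differentiable_U[OF smooth2(2)] assms)+)
    (simp add: M'_def m0_def m1_def m2_def algebra_simps power2_eq_square)

lemma has_total_deriv_N:
  assumes "base j \<in> U"
  shows "has_total_deriv (\<lambda>j. N (base j) (jet_y2 j))
    (N' (base j) (jet_y2 j) + \<psi>1 (base j) * jet_y3 j) j"
  unfolding N_def
  by (rule has_total_deriv_eq, (rule has_total_deriv_add has_total_deriv_mult has_total_deriv_jet_y2
      has_total_deriv_base differentiable_U[OF smooth2(3)] differentiable_U[OF smooth2(4)] assms)+)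
    (simp add: N'_def n0_def n1_def n2_def algebra_simps power2_eq_square)

lemma has_total_deriv_Q:
  assumes "base j \<in> U"
  shows "has_total_deriv (\<lambda>j. Q (base j) (jet_y2 j))
    (Q' (base j) (jet_y2 j) + Q_s (base j) (jet_y2 j) * jet_y3 j) j"
  unfolding Q_def
  by (rule has_total_deriv_eq, (rule has_total_deriv_add has_total_deriv_mult has_total_deriv_jet_y2
      has_total_deriv_power has_total_deriv_base differentiable_U[OF smooth1_q(1)]
      differentiable_U[OF smooth1_q(2)] differentiable_U[OF smooth1_q(3)]
      differentiable_U[OF smooth1_q(4)] assms)+)
    (simp add: Q'_def Q_s_def e0_def e1_def e2_def e3_def e4_def algebra_simps
      power2_eq_square power3_eq_cube power4_eq_xxxx)

lemma u1_eq:
  assumes "base j \<in> U"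
  shows "u1 \<phi> \<psi> j = N (base j) (jet_y2 j) / M (base j) (jet_y2 j)"
  using assms by (simp add: u1_def total_deriv_\<phi> total_deriv_\<psi>)

text \<open>In the numerator of \<open>D(N / M)\<close> the coefficient of \<open>y'''\<close> is \<open>\<psi>1 M - N \<phi>1 = w\<close>, so the
  highest derivative enters exactly through the non-contact determinant.\<close>

lemma u2_eq:
  assumes "j \<in> jet_domain \<phi> U"
  shows "u2 \<phi> \<psi> j =
    (w (base j) * jet_y3 j + Q (base j) (jet_y2 j)) / M (base j) (jet_y2 j) ^ 3"
proof -
  let ?M = "M (base j) (jet_y2 j)" and ?N = "N (base j) (jet_y2 j)"
  have j: "base j \<in> U" "?M \<noteq> 0" using assms by (auto simp: jet_domain_iff)
  have "has_total_deriv (u1 \<phi> \<psi>)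
      (((N' (base j) (jet_y2 j) + \<psi>1 (base j) * jet_y3 j) * ?M
        - ?N * (M' (base j) (jet_y2 j) + \<phi>1 (base j) * jet_y3 j)) / ?M\<^sup>2) j"
    by (rule has_total_deriv_transform_open[OF has_total_deriv_divide[OF has_total_deriv_N
          has_total_deriv_M] open_base_U]) (use j u1_eq in auto)
  also have "(N' (base j) (jet_y2 j) + \<psi>1 (base j) * jet_y3 j) * ?M
        - ?N * (M' (base j) (jet_y2 j) + \<phi>1 (base j) * jet_y3 j)
      = w (base j) * jet_y3 j + Q (base j) (jet_y2 j)"
    unfolding w_eq[of _ "jet_y2 j"] Q_eq by (simp add: algebra_simps)
  finally have "total_deriv (u1 \<phi> \<psi>) j = (w (base j) * jet_y3 j + Q (base j) (jet_y2 j)) / ?M\<^sup>2"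
    by (rule has_total_deriv_imp_total_deriv)
  then show ?thesis
    using j by (simp add: u2_def total_deriv_\<phi> power2_eq_square power3_eq_cube)
qed

lemma u3_eq:
  assumes "j \<in> jet_domain \<phi> U"
  shows "u3 \<phi> \<psi> j =
    (M (base j) (jet_y2 j) * (w (base j) * jet_y4 j
        + (w0 (base j) + w1 (base j) * jet_y2 j + Q_s (base j) (jet_y2 j)) * jet_y3 j
        + Q' (base j) (jet_y2 j))
      - 3 * (w (base j) * jet_y3 j + Q (base j) (jet_y2 j))
          * (M' (base j) (jet_y2 j) + \<phi>1 (base j) * jet_y3 j))
    / M (base j) (jet_y2 j) ^ 5"
    (is "_ = (_ * ?DG - 3 * ?G * ?DM) / _")
proof -
  let ?M = "M (base j) (jet_y2 j)"
  have j: "base j \<in> U" "?M \<noteq> 0" using assms by (auto simp: jet_domain_iff)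
  have "has_total_deriv (\<lambda>j. w (base j) * jet_y3 j + Q (base j) (jet_y2 j)) ?DG j"
    by (rule has_total_deriv_eq, (rule has_total_deriv_add has_total_deriv_mult has_total_deriv_jet_y3
        has_total_deriv_Q has_total_deriv_base differentiable_U[OF smooth1(7)] j(1))+)
      (simp add: w0_def w1_def algebra_simps)
  from has_total_deriv_divide[OF this has_total_deriv_power[OF has_total_deriv_M], of 3] j
  have "has_total_deriv
      (\<lambda>j. (w (base j) * jet_y3 j + Q (base j) (jet_y2 j)) / M (base j) (jet_y2 j) ^ 3)
      ((?DG * ?M ^ 3 - ?G * (3 * ?M ^ 2 * ?DM)) / (?M ^ 3)\<^sup>2) j"
    by simp
  then have "has_total_deriv (u2 \<phi> \<psi>)
      ((?DG * ?M ^ 3 - ?G * (3 * ?M ^ 2 * ?DM)) / (?M ^ 3)\<^sup>2) j"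
    by (rule has_total_deriv_transform_open[OF _ open_jet_domain assms]) (simp add: u2_eq)
  then have "u3 \<phi> \<psi> j = (?DG * ?M ^ 3 - ?G * (3 * ?M ^ 2 * ?DM)) / (?M ^ 3)\<^sup>2 / ?M"
    using j by (simp add: u3_def total_deriv_\<phi> has_total_deriv_imp_total_deriv)
  \<comment> \<open>The quotient rule produces the denominator \<open>M\<^sup>7\<close>, of which a factor \<open>M\<^sup>2\<close> is spurious.\<close>
  also have "\<dots> = (?M ^ 2 * (?M * ?DG - 3 * ?G * ?DM)) / (?M ^ 2 * ?M ^ 5)"
    by (simp add: algebra_simps power2_eq_square power3_eq_cube eval_nat_numeral)
  also have "\<dots> = (?M * ?DG - 3 * ?G * ?DM) / ?M ^ 5"
    by (rule mult_divide_mult_cancel_left) (use j in simp)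
  finally show ?thesis .
qed

subsection \<open>The normalized equation\<close>

text \<open>What remains of the numerator over \<open>M\<^sup>5\<close> of \<open>u''' + \<alpha>(t) u\<close> once the term \<open>M w y''''\<close> is
  removed, sorted by powers of \<open>y'''\<close> and \<open>s = y''\<close>. Both normal forms come from it.\<close>

definition "R z s y3 = - 3 * w z * \<phi>1 z * y3 ^ 2 + (g2 z * s ^ 2 + g1 z * s + g0 z) * y3
  + h5 z * s ^ 5 + h4 z * s ^ 4 + h3 z * s ^ 3 + h2 z * s ^ 2 + h1 z * s + h0 z"

lemma R_eq:
  "R z s y3 = M z s * ((w0 z + w1 z * s + Q_s z s) * y3 + Q' z s)
     - 3 * (w z * y3 + Q z s) * (M' z s + \<phi>1 z * y3) + \<beta> z * M z s ^ 5"
  unfolding R_def g0_def g1_def g2_def h0_def h1_def h2_def h3_def h4_def h5_def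
    M_def Q_s_def Q'_def Q_def M'_def
  by algebra

lemma transformed_lhs_eq:
  assumes "(x, y, p, y2, y3, y4) \<in> jet_domain \<phi> U"
  shows "transformed_lhs \<alpha> \<phi> \<psi> (x, y, p, y2, y3, y4) =
    w (x, y, p) / M (x, y, p) y2 ^ 4 * y4 + R (x, y, p) y2 y3 / M (x, y, p) y2 ^ 5"
proof -
  let ?z = "(x, y, p)"
  let ?M = "M ?z y2"
  have M: "?M \<noteq> 0" using assms by (simp add: jet_domain_iff)
  let ?G = "w ?z * y3 + Q ?z y2" and ?DM = "M' ?z y2 + \<phi>1 ?z * y3"
    and ?DG = "w ?z * y4 + (w0 ?z + w1 ?z * y2 + Q_s ?z y2) * y3 + Q' ?z y2"
  have "transformed_lhs \<alpha> \<phi> \<psi> (x, y, p, y2, y3, y4) = (?M * ?DG - 3 * ?G * ?DM) / ?M ^ 5 + \<beta> ?z"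
    by (simp add: transformed_lhs_def u3_eq[OF assms] lift_def \<beta>_def)
  also have "?M * ?DG - 3 * ?G * ?DM = ?M * (w ?z * y4) + R ?z y2 y3 - ?M ^ 5 * \<beta> ?z"
    unfolding R_eq by (simp only: ring_distribs mult_ac)
  also have "(?M * (w ?z * y4) + R ?z y2 y3 - ?M ^ 5 * \<beta> ?z) / ?M ^ 5 + \<beta> ?z =
      ?M * (w ?z * y4) / (?M * ?M ^ 4) + R ?z y2 y3 / ?M ^ 5"
    using M by (simp add: add_divide_distrib diff_divide_distrib power_Suc[symmetric] del: power_Suc)
  also have "?M * (w ?z * y4) / (?M * ?M ^ 4) = w ?z / ?M ^ 4 * y4"
    using M by simp
  finally show ?thesis .
qed

lemma top_coeff_eq:
  assumes "(x, y, p, y2, y3, y4) \<in> jet_domain \<phi> U"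
  shows "top_coeff \<alpha> \<phi> \<psi> (x, y, p, y2, y3, y4) = w (x, y, p) / M (x, y, p) y2 ^ 4"
proof -
  \<comment> \<open>The jet domain imposes no condition on \<open>y''''\<close>, so the whole line stays inside it.\<close>
  have "(x, y, p, y2, y3, y4 + s) \<in> jet_domain \<phi> U" for s
    using assms by (simp add: jet_domain_iff)
  then have "(\<lambda>s. transformed_lhs \<alpha> \<phi> \<psi> ((x, y, p, y2, y3, y4) + s *\<^sub>R (0, 0, 0, 0, 0, 1))) =
    (\<lambda>s. w (x, y, p) / M (x, y, p) y2 ^ 4 * (y4 + s) + R (x, y, p) y2 y3 / M (x, y, p) y2 ^ 5)"
    by (simp add: transformed_lhs_eq)
  moreover have "((\<lambda>s. a * (y4 + s) + b) has_real_derivative a) (at 0)" for a b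
    by (auto intro!: derivative_eq_intros)
  ultimately show ?thesis
    unfolding top_coeff_def partial_deriv_def by (simp only: DERIV_imp_deriv)
qed

lemma top_coeff_nonzero:
  assumes "j \<in> jet_domain \<phi> U"
  shows "top_coeff \<alpha> \<phi> \<psi> j \<noteq> 0"
  using assms w_nonzero
  by (cases j) (auto simp: top_coeff_eq, auto simp: jet_domain_iff)

lemma normalized_lhs_eq:
  assumes "(x, y, p, y2, y3, y4) \<in> jet_domain \<phi> U"
  shows "normalized_lhs \<alpha> \<phi> \<psi> (x, y, p, y2, y3, y4) =
    y4 + R (x, y, p) y2 y3 / (w (x, y, p) * M (x, y, p) y2)"
proof -
  have "M (x, y, p) y2 \<noteq> 0" "w (x, y, p) \<noteq> 0"
    using assms w_nonzero by (auto simp: jet_domain_iff)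
  then show ?thesis
    unfolding normalized_lhs_def transformed_lhs_eq[OF assms] top_coeff_eq[OF assms]
    by (simp add: field_simps eval_nat_numeral)
qed

subsection \<open>The two normal forms\<close>

text \<open>Since \<open>\<phi>1\<close> vanishes on an open set, so do its derivatives. Hence \<open>m2 = 0\<close>, then \<open>q3 = 0\<close>, then
  \<open>e4 = 0\<close>, so that \<open>M\<close>, \<open>M'\<close>, \<open>Q\<close>, \<open>Q'\<close> all lose their leading coefficients in \<open>y''\<close>.\<close>

lemma degenerate_coefficients:
  assumes "\<forall>z\<in>U. \<phi>1 z = 0" "z \<in> U"
  shows "g2 z = 0" "h4 z = 0" "h5 z = 0"
proof -
  have zero: "partial_deriv b f z = 0" if "\<And>x. x \<in> U \<Longrightarrow> f x = 0" "z \<in> U" for b f z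
    using partial_deriv_cong_open[OF open_U \<open>z \<in> U\<close>, of f "\<lambda>z. 0"] that(1)
    by (simp add: partial_deriv_def)
  have m2: "m2 x = 0" if "x \<in> U" for x
    using zero[of \<phi>1 x] assms(1) that by (simp add: m2_def)
  have q3: "q3 x = 0" if "x \<in> U" for x
    using m2 assms(1) that by (simp add: q3_def)
  have "e4 z = 0"
    using zero[of q3 z] q3 assms(2) by (simp add: e4_def)
  then show "g2 z = 0" "h4 z = 0" "h5 z = 0"
    using assms m2 q3 by (simp_all add: g2_def h4_def h5_def)
qed

text \<open>If \<open>\<phi>1 = 0\<close>, the denominator \<open>w M\<close> reduces to the function \<open>w \<phi>0\<close> of \<open>x, y, p\<close>. It has no
  zero on all of \<open>U\<close>, because there \<open>w = \<phi>0 \<psi>1\<close>.\<close>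

lemma form_degenerate:
  assumes zero: "\<forall>z\<in>U. \<phi>1 z = 0"
  shows "\<exists>A0 A1 B0 B1 B2 B3.
        (\<forall>f\<in>{A0, A1, B0, B1, B2, B3}. C_k_on k U f) \<and>
        (\<forall>x y p y2 y3 y4. (x, y, p, y2, y3, y4) \<in> jet_domain \<phi> U \<longrightarrow>
          normalized_lhs \<alpha> \<phi> \<psi> (x, y, p, y2, y3, y4) =
            y4 + (A1 (x, y, p) * y2 + A0 (x, y, p)) * y3
            + B3 (x, y, p) * y2 ^ 3 + B2 (x, y, p) * y2 ^ 2
            + B1 (x, y, p) * y2 + B0 (x, y, p))"
proof -
  define K where "K z = w z * \<phi>0 z" for z
  have K_nonzero: "K z \<noteq> 0" if "z \<in> U" for z
    using w_nonzero[OF that] zero that by (auto simp: K_def w_def)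
  have quot: "C_k_on k U (\<lambda>z. f z / K z)" if "C_k_on k U f" for f
    unfolding K_def
    by (intro C_k_on_divide[OF open_U] that C_k_on_mult[OF open_U] smooth0)
       (use K_nonzero in \<open>simp add: K_def\<close>)
  show ?thesis
  proof (intro exI conjI allI impI)
    show "\<forall>f\<in>{\<lambda>z. g0 z / K z, \<lambda>z. g1 z / K z, \<lambda>z. h0 z / K z, \<lambda>z. h1 z / K z,
        \<lambda>z. h2 z / K z, \<lambda>z. h3 z / K z}. C_k_on k U f"
      using smooth_coefficients by (auto intro!: quot simp del: C_k_on.simps)
  next
    fix x y p y2 y3 y4 :: real
    let ?z = "(x, y, p)"
    assume j: "(x, y, p, y2, y3, y4) \<in> jet_domain \<phi> U"
    then have z: "?z \<in> U" by (simp add: jet_domain_iff)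
    have M: "w ?z * M ?z y2 = K ?z"
      using zero z by (simp add: M_def K_def)
    show "normalized_lhs \<alpha> \<phi> \<psi> (x, y, p, y2, y3, y4) =
            y4 + (g1 ?z / K ?z * y2 + g0 ?z / K ?z) * y3 + h3 ?z / K ?z * y2 ^ 3
            + h2 ?z / K ?z * y2 ^ 2 + h1 ?z / K ?z * y2 + h0 ?z / K ?z"
      unfolding normalized_lhs_eq[OF j] M R_def
      using degenerate_coefficients[OF zero z] zero z K_nonzero[OF z]
      by (simp add: add_divide_distrib algebra_simps)
  qed
qed

text \<open>If \<open>\<phi>1\<close> has no zero, the linear polynomial \<open>M\<close> is \<open>\<phi>1 (y'' + r)\<close>, and
  \<open>-3 w \<phi>1 y'''\<^sup>2\<close> in \<open>R\<close> turns into the universal term \<open>-3 y'''\<^sup>2\<close> after division by \<open>w \<phi>1\<close>.\<close>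

lemma form_generic:
  assumes nonzero: "\<forall>z\<in>U. \<phi>1 z \<noteq> 0"
  shows "\<exists>r C0 C1 C2 D0 D1 D2 D3 D4 D5.
        (\<forall>f\<in>{r, C0, C1, C2, D0, D1, D2, D3, D4, D5}. C_k_on k U f) \<and>
        (\<forall>x y p y2 y3 y4. (x, y, p, y2, y3, y4) \<in> jet_domain \<phi> U \<longrightarrow>
          y2 + r (x, y, p) \<noteq> 0 \<and>
          normalized_lhs \<alpha> \<phi> \<psi> (x, y, p, y2, y3, y4) =
            y4 + 1 / (y2 + r (x, y, p)) *
              (- 3 * y3 ^ 2
               + (C2 (x, y, p) * y2 ^ 2 + C1 (x, y, p) * y2 + C0 (x, y, p)) * y3
               + D5 (x, y, p) * y2 ^ 5 + D4 (x, y, p) * y2 ^ 4 + D3 (x, y, p) * y2 ^ 3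
               + D2 (x, y, p) * y2 ^ 2 + D1 (x, y, p) * y2 + D0 (x, y, p)))"
proof -
  define K where "K z = w z * \<phi>1 z" for z
  define r where "r z = \<phi>0 z / \<phi>1 z" for z
  have K_nonzero: "K z \<noteq> 0" if "z \<in> U" for z
    using w_nonzero[OF that] nonzero that by (auto simp: K_def)
  have quot: "C_k_on k U (\<lambda>z. f z / K z)" if "C_k_on k U f" for f
    unfolding K_def
    by (intro C_k_on_divide[OF open_U] that C_k_on_mult[OF open_U] smooth0)
       (use K_nonzero in \<open>simp add: K_def\<close>)
  have smooth_r: "C_k_on k U r"
    unfolding r_def[abs_def]
    by (intro C_k_on_divide[OF open_U] smooth0) (use nonzero in simp)
  show ?thesis
  proof (intro exI conjI allI impI)
    show "\<forall>f\<in>{r, \<lambda>z. g0 z / K z, \<lambda>z. g1 z / K z, \<lambda>z. g2 z / K z,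
        \<lambda>z. h0 z / K z, \<lambda>z. h1 z / K z, \<lambda>z. h2 z / K z, \<lambda>z. h3 z / K z,
        \<lambda>z. h4 z / K z, \<lambda>z. h5 z / K z}. C_k_on k U f"
      using smooth_coefficients smooth_r by (auto intro!: quot simp del: C_k_on.simps)
  next
    fix x y p y2 y3 y4 :: real
    let ?z = "(x, y, p)"
    assume j: "(x, y, p, y2, y3, y4) \<in> jet_domain \<phi> U"
    then have z: "?z \<in> U" by (simp add: jet_domain_iff)
    have M: "M ?z y2 = \<phi>1 ?z * (y2 + r ?z)"
      using nonzero z by (simp add: M_def r_def field_simps)
    then show "y2 + r ?z \<noteq> 0"
      using j by (auto simp: jet_domain_iff)
    have "R ?z y2 y3 / (w ?z * M ?z y2) = 1 / (y2 + r ?z) * (R ?z y2 y3 / K ?z)"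
      by (simp add: M K_def)
    also have "R ?z y2 y3 / K ?z = - 3 * y3 ^ 2
        + (g2 ?z / K ?z * y2 ^ 2 + g1 ?z / K ?z * y2 + g0 ?z / K ?z) * y3
        + h5 ?z / K ?z * y2 ^ 5 + h4 ?z / K ?z * y2 ^ 4 + h3 ?z / K ?z * y2 ^ 3
        + h2 ?z / K ?z * y2 ^ 2 + h1 ?z / K ?z * y2 + h0 ?z / K ?z"
    proof -
      have "- 3 * w ?z * \<phi>1 ?z * y3 ^ 2 / K ?z = - 3 * y3 ^ 2"
        using K_nonzero[OF z] by (simp add: K_def)
      then show ?thesis
        unfolding R_def by (simp add: add_divide_distrib diff_divide_distrib distrib_right)
    qed
    finally show "normalized_lhs \<alpha> \<phi> \<psi> (x, y, p, y2, y3, y4) =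
            y4 + 1 / (y2 + r ?z) *
              (- 3 * y3 ^ 2
               + (g2 ?z / K ?z * y2 ^ 2 + g1 ?z / K ?z * y2 + g0 ?z / K ?z) * y3
               + h5 ?z / K ?z * y2 ^ 5 + h4 ?z / K ?z * y2 ^ 4 + h3 ?z / K ?z * y2 ^ 3
               + h2 ?z / K ?z * y2 ^ 2 + h1 ?z / K ?z * y2 + h0 ?z / K ?z)"
      unfolding normalized_lhs_eq[OF j] by simp
  qed
qed

end

theorem theorem1:
  fixes \<alpha> :: "real \<Rightarrow> real"
    and \<phi> \<psi> :: "real \<times> real \<times> real \<Rightarrow> real"
    and U :: "(real \<times> real \<times> real) set"
    and T :: "real set"
    and k :: nat
  assumes "open U" and "open T" and "\<phi> ` U \<subseteq> T"
    and "C_k_on (k + 3) U \<phi>" and "C_k_on (k + 3) U \<psi>" and "C_k_on k T \<alpha>"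
    and non_contact: "\<And>x y p. (x, y, p) \<in> U \<Longrightarrow>
      d_p \<phi> (x, y, p) * (d_x \<psi> (x, y, p) + p * d_y \<psi> (x, y, p))
      - d_p \<psi> (x, y, p) * (d_x \<phi> (x, y, p) + p * d_y \<phi> (x, y, p)) \<noteq> 0"
    and "(\<forall>z\<in>U. d_p \<phi> z = 0) \<or> (\<forall>z\<in>U. d_p \<phi> z \<noteq> 0)"
  shows "(\<forall>j\<in>jet_domain \<phi> U. top_coeff \<alpha> \<phi> \<psi> j \<noteq> 0) \<and>
    ((\<exists>A0 A1 B0 B1 B2 B3.
        (\<forall>f\<in>{A0, A1, B0, B1, B2, B3}. C_k_on k U f) \<and>
        (\<forall>x y p y2 y3 y4. (x, y, p, y2, y3, y4) \<in> jet_domain \<phi> U \<longrightarrow>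
          normalized_lhs \<alpha> \<phi> \<psi> (x, y, p, y2, y3, y4) =
            y4 + (A1 (x, y, p) * y2 + A0 (x, y, p)) * y3
            + B3 (x, y, p) * y2 ^ 3 + B2 (x, y, p) * y2 ^ 2
            + B1 (x, y, p) * y2 + B0 (x, y, p)))
     \<or>
     (\<exists>r C0 C1 C2 D0 D1 D2 D3 D4 D5.
        (\<forall>f\<in>{r, C0, C1, C2, D0, D1, D2, D3, D4, D5}. C_k_on k U f) \<and>
        (\<forall>x y p y2 y3 y4. (x, y, p, y2, y3, y4) \<in> jet_domain \<phi> U \<longrightarrow>
          y2 + r (x, y, p) \<noteq> 0 \<and>
          normalized_lhs \<alpha> \<phi> \<psi> (x, y, p, y2, y3, y4) =
            y4 + 1 / (y2 + r (x, y, p)) *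
              (- 3 * y3 ^ 2
               + (C2 (x, y, p) * y2 ^ 2 + C1 (x, y, p) * y2 + C0 (x, y, p)) * y3
               + D5 (x, y, p) * y2 ^ 5 + D4 (x, y, p) * y2 ^ 4 + D3 (x, y, p) * y2 ^ 3
               + D2 (x, y, p) * y2 ^ 2 + D1 (x, y, p) * y2 + D0 (x, y, p)))))"
proof -
  interpret tangent_transformation \<alpha> \<phi> \<psi> U T k
  proof
    show "d_xy \<phi> z * d_p \<psi> z - d_p \<phi> z * d_xy \<psi> z \<noteq> 0" if "z \<in> U" for z
    proof (cases z)
      case (fields x y p)
      then show ?thesis
        using non_contact[of x y p] that by (simp add: d_xy_def mult.commute)
    qed
  qed (use assms in auto)
  have "(\<forall>z\<in>U. \<phi>1 z = 0) \<or> (\<forall>z\<in>U. \<phi>1 z \<noteq> 0)"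
    using assms(8) by (simp add: \<phi>1_def)
  then show ?thesis
  proof
    assume "\<forall>z\<in>U. \<phi>1 z = 0"
    from form_degenerate[OF this] show ?thesis
      using top_coeff_nonzero by (intro conjI disjI1 ballI)
  next
    assume "\<forall>z\<in>U. \<phi>1 z \<noteq> 0"
    from form_generic[OF this] show ?thesis
      using top_coeff_nonzero by (intro conjI disjI2 ballI)
  qed
qed

end
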